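(* Consider the $N$-state delegation problem with Shannon information costs described in the context, with principal's prior $\mu_p$ satisfying $\mu_p(\omega_1)\ge\dots\ge\mu_p(\omega_N)$. Let $\bar\beta=\beta_{\mu_p}$ be the unconditional choice probabilities of the aligned agent (prior $\mu_p$) and $\beta^*=\beta_{\mu^*}$ those of the optimally chosen agent, with prior $\mu^*(\omega_i)=\sqrt{\mu_p(\omega_i)}\big/\sum_{j=1}^N\sqrt{\mu_p(\omega_j)}$. Let $\bar C=\{a\in\mathcal A:\bar\beta(a)>0\}$ and $C^*=\{a\in\mathcal A:\beta^*(a)>0\}$. Then $\bar C\subseteq C^*$.
   Context: $N>2$; states $\Omega=\{\omega_1,\dots,\omega_N\}$, actions $\mathcal A=\{a_1,\dots,a_N\}$, payoffs $u(a_i,\omega_i)=1$ and $u(a_i,\omega_j)=0$ for $i\ne j$. Agent's problem. An agent with prior $\mu\in\Delta(\Omega)$ chooses a decision rule $\pi:\Omega\to\Delta(\mathcal A)$ to maximize $$\sum_j\mu(\omega_j)\sum_i\pi(a_i|\omega_j)u(a_i,\omega_j)-\lambda\sum_{j}\sum_{i}\mu(\omega_j)\pi(a_i|\omega_j)\ln\frac{\pi(a_i|\omega_j)}{\beta(a_i)},\qquad \beta(a_i)=\sum_j\mu(\omega_j)\pi(a_i|\omega_j),$$ with $\lambda>0$ and $0\ln0=0$ (the second term is the Shannon entropy cost of information). For the solution $\pi^*_\mu$, the unconditional choice probabilities as perceived by the agent are $\beta_\mu(a_i)=\sum_j\mu(\omega_j)\pi^*_\mu(a_i|\omega_j)$.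 *)

theory Defs
  imports Complex_Main
begin

text \<open>
  The indices \<open>1..N\<close> serve both for the states \<open>\<omega>\<^sub>1, \<dots>, \<omega>\<^sub>N\<close> and for the
  actions \<open>a\<^sub>1, \<dots>, a\<^sub>N\<close>. Distributions and decision rules are plain functions
  of which only the values at indices in \<open>1..N\<close> are ever used.
\<close>

definition distribution :: "nat \<Rightarrow> (nat \<Rightarrow> real) \<Rightarrow> bool" where
  "distribution N p \<longleftrightarrow> (\<forall>i\<in>{1..N}. 0 \<le> p i) \<and> (\<Sum>i=1..N. p i) = 1"

text \<open>\<open>\<pi> j i\<close> is the probability \<open>\<pi>(a\<^sub>i | \<omega>\<^sub>j)\<close>.\<close>

definition decision_rule :: "nat \<Rightarrow> (nat \<Rightarrow> nat \<Rightarrow> real) \<Rightarrow> bool" where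
  "decision_rule N \<pi> \<longleftrightarrow> (\<forall>j\<in>{1..N}. distribution N (\<pi> j))"

definition payoff :: "nat \<Rightarrow> nat \<Rightarrow> real" where
  "payoff i j = (if i = j then 1 else 0)"

definition choice_prob :: "nat \<Rightarrow> (nat \<Rightarrow> real) \<Rightarrow> (nat \<Rightarrow> nat \<Rightarrow> real) \<Rightarrow> nat \<Rightarrow> real" where
  "choice_prob N \<mu> \<pi> i = (\<Sum>j=1..N. \<mu> j * \<pi> j i)"

text \<open>
  The convention \<open>0 ln 0 = 0\<close> is automatic, since a zero factor annihilates the total
  function \<open>ln\<close>. The quotient is harmless as well: if \<open>choice_prob N \<mu> \<pi> i = 0\<close>
  then \<open>\<mu> j * \<pi> j i = 0\<close> for every \<open>j\<close>, so the summand vanishes.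
\<close>

definition information_cost :: "nat \<Rightarrow> (nat \<Rightarrow> real) \<Rightarrow> (nat \<Rightarrow> nat \<Rightarrow> real) \<Rightarrow> real" where
  "information_cost N \<mu> \<pi> =
     (\<Sum>j=1..N. \<Sum>i=1..N. \<mu> j * \<pi> j i * ln (\<pi> j i / choice_prob N \<mu> \<pi> i))"

definition agent_objective ::
  "nat \<Rightarrow> real \<Rightarrow> (nat \<Rightarrow> real) \<Rightarrow> (nat \<Rightarrow> nat \<Rightarrow> real) \<Rightarrow> real" where
  "agent_objective N lam \<mu> \<pi> =
     (\<Sum>j=1..N. \<mu> j * (\<Sum>i=1..N. \<pi> j i * payoff i j)) - lam * information_cost N \<mu> \<pi>"

definition agent_solution ::
  "nat \<Rightarrow> real \<Rightarrow> (nat \<Rightarrow> real) \<Rightarrow> (nat \<Rightarrow> nat \<Rightarrow> real) \<Rightarrow> bool" where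
  "agent_solution N lam \<mu> \<pi> \<longleftrightarrow> is_arg_max (agent_objective N lam \<mu>) (decision_rule N) \<pi>"

definition consideration_set ::
  "nat \<Rightarrow> (nat \<Rightarrow> real) \<Rightarrow> (nat \<Rightarrow> nat \<Rightarrow> real) \<Rightarrow> nat set" where
  "consideration_set N \<mu> \<pi> = {i \<in> {1..N}. choice_prob N \<mu> \<pi> i > 0}"

definition optimal_agent_prior :: "nat \<Rightarrow> (nat \<Rightarrow> real) \<Rightarrow> nat \<Rightarrow> real" where
  "optimal_agent_prior N \<mu> i = sqrt (\<mu> i) / (\<Sum>j=1..N. sqrt (\<mu> j))"

end

theory Submission imports Defs begin

text \<open>
  Maximizing over decision rules with given unconditional choice probabilities \<open>q\<close> reduces the
  agent's problem to maximizing \<open>\<Sum>\<^sub>j \<mu>\<^sub>j ln (1 + K q\<^sub>j)\<close> over the simplex, where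
  \<open>K = exp (1/\<lambda>) - 1\<close>: by Gibbs' inequality the best rule is the logit rule
  \<open>q\<^sub>i exp (u\<^sub>i\<^sub>j/\<lambda>) / (1 + K q\<^sub>j)\<close>. The first-order conditions read
  \<open>\<mu>\<^sub>i / (1 + K q\<^sub>i) \<le> \<mu>\<^sub>j / (1 + K q\<^sub>j)\<close> whenever \<open>q\<^sub>j > 0\<close>.
  Suppose the aligned agent considers \<open>i\<close> but the optimal agent does not. For every \<open>j\<close> that
  the optimal agent considers, the first-order conditions give
  \<open>1 + K \<beta>\<^sup>*\<^sub>j \<le> sqrt (\<mu>\<^sub>j / \<mu>\<^sub>i)\<close>, hence
  \<open>1 + K \<beta>\<^sup>*\<^sub>j \<le> (1 + K \<beta>\<^sup>*\<^sub>j)\<^sup>2 \<le> \<mu>\<^sub>j / \<mu>\<^sub>i < 1 + K \<beta>\<^sub>j\<close>, where \<open>\<beta>\<close> belongs to the aligned agent.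
  Summing over these \<open>j\<close> yields \<open>1 < 1\<close>.
\<close>

section \<open>Gibbs' inequality and logit rules\<close>

definition logit_rule :: "real \<Rightarrow> (nat \<Rightarrow> real) \<Rightarrow> nat \<Rightarrow> nat \<Rightarrow> real" where
  "logit_rule lam q j i = q i * exp (payoff i j / lam) / (1 + (exp (1 / lam) - 1) * q j)"

definition reduced_objective :: "nat \<Rightarrow> real \<Rightarrow> (nat \<Rightarrow> real) \<Rightarrow> (nat \<Rightarrow> real) \<Rightarrow> real" where
  "reduced_objective N lam \<mu> q = (\<Sum>j=1..N. \<mu> j * ln (1 + (exp (1 / lam) - 1) * q j))"

text \<open>Holds term by term from \<open>ln x \<le> x - 1\<close> at \<open>x = w i / p i\<close>.
  When both totals are 1, it says that the divergence of \<open>p\<close> from \<open>w\<close> is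
  nonnegative.\<close>

lemma gibbs_sum:
  fixes p w :: "'a \<Rightarrow> real"
  assumes "\<And>i. i \<in> A \<Longrightarrow> 0 \<le> p i" "\<And>i. i \<in> A \<Longrightarrow> 0 \<le> w i"
    and "\<And>i. i \<in> A \<Longrightarrow> w i = 0 \<Longrightarrow> p i = 0"
  shows "sum p A - sum w A \<le> (\<Sum>i\<in>A. p i * ln (p i / w i))"
proof -
  have "p i - w i \<le> p i * ln (p i / w i)" if i: "i \<in> A" for i
  proof (cases "p i = 0")
    case True
    then show ?thesis using assms(2)[OF i] by simp
  next
    case False
    then have pos: "p i > 0" "w i > 0"
      using assms[OF i] by (force simp: order_less_le)+
    have "ln (w i / p i) \<le> w i / p i - 1"
      using pos by (intro ln_le_minus_one) simp
    then have "p i * ln (w i / p i) \<le> p i * (w i / p i - 1)"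
      using pos by (intro mult_left_mono) auto
    then show ?thesis using pos by (simp add: ln_div algebra_simps)
  qed
  then show ?thesis by (simp add: sum_subtractf[symmetric] sum_mono)
qed

lemma partition_pos:
  fixes lam x :: real
  assumes "lam > 0" "x \<ge> 0"
  shows "1 + (exp (1 / lam) - 1) * x > 0"
proof -
  have "(exp (1 / lam) - 1) * x \<ge> 0" using assms by simp
  then show ?thesis by linarith
qed

lemma logit_rule_distribution:
  assumes "lam > 0" "distribution N q" "j \<in> {1..N}"
  shows "distribution N (logit_rule lam q j)"
proof -
  let ?K = "exp (1 / lam) - 1"
  have q: "q i \<ge> 0" if "i \<in> {1..N}" for i using assms(2) that by (simp add: distribution_def)
  have Z: "1 + ?K * q j > 0" using partition_pos[OF assms(1) q[OF assms(3)]] .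
  \<comment> \<open>Only action \<open>j\<close> pays in state \<open>j\<close>, so the exponential
    factor is 1 elsewhere and exceeds 1 by \<open>?K\<close> there; since \<open>q\<close> sums to
    1, the normalizer has a closed form.\<close>
  have "(\<Sum>i=1..N. q i * exp (payoff i j / lam)) = (\<Sum>i=1..N. q i + (if i = j then ?K * q i else 0))"
    by (intro sum.cong) (auto simp: payoff_def algebra_simps)
  also have "\<dots> = 1 + ?K * q j"
    using assms(2,3) by (simp add: sum.distrib distribution_def)
  finally have "(\<Sum>i=1..N. logit_rule lam q j i) = 1"
    using Z by (simp add: logit_rule_def sum_divide_distrib[symmetric])
  moreover have "0 \<le> logit_rule lam q j i" if "i \<in> {1..N}" for i
    using q[OF that] Z by (simp add: logit_rule_def)
  ultimately show ?thesis by (simp add: distribution_def)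
qed

lemma logit_rule_eq_0_iff:
  assumes "lam > 0" "distribution N q" "j \<in> {1..N}"
  shows "logit_rule lam q j i = 0 \<longleftrightarrow> q i = 0"
  using partition_pos[OF assms(1), of "q j"] assms(2,3)
  by (auto simp: logit_rule_def distribution_def)

text \<open>Taking logarithms in the logit formula gives \<open>ln (p i / logit_rule lam q j i) = ln
  (p i / q i) - payoff i j / lam + ln Z\<close>, where Z is the normalizer. Averaging over
  \<open>p\<close> turns payoff minus cost into a term independent of \<open>p\<close> minus a
  divergence from the logit rule.\<close>

lemma payoff_minus_divergence:
  assumes "lam > 0" "distribution N q" "distribution N p" "j \<in> {1..N}"
    and supp: "\<And>i. i \<in> {1..N} \<Longrightarrow> q i = 0 \<Longrightarrow> p i = 0"
  shows "(\<Sum>i=1..N. p i * payoff i j) - lam * (\<Sum>i=1..N. p i * ln (p i / q i))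
    = lam * ln (1 + (exp (1 / lam) - 1) * q j) - lam * (\<Sum>i=1..N. p i * ln (p i / logit_rule lam q j i))"
proof -
  let ?Z = "1 + (exp (1 / lam) - 1) * q j"
  have Z: "?Z > 0"
    using assms partition_pos by (simp add: distribution_def)
  have "p i * payoff i j - lam * (p i * ln (p i / q i))
      = p i * (lam * ln ?Z) - lam * (p i * ln (p i / logit_rule lam q j i))" if i: "i \<in> {1..N}" for i
  proof (cases "p i = 0")
    case False
    then have pos: "p i > 0" "q i > 0"
      using assms(2,3) supp[OF i] i by (force simp: distribution_def order_less_le)+
    have "ln (p i / logit_rule lam q j i) = ln (p i / q i) - payoff i j / lam + ln ?Z"
      using pos Z by (simp add: logit_rule_def ln_div ln_mult)
    then have "lam * ln (p i / logit_rule lam q j i) = lam * ln (p i / q i) - payoff i j + lam * ln ?Z"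
      using assms(1) by (simp add: right_diff_distrib distrib_left)
    then have "p i * (lam * ln (p i / logit_rule lam q j i))
        = p i * (lam * ln (p i / q i) - payoff i j + lam * ln ?Z)"
      by (rule arg_cong)
    then show ?thesis by (simp only: right_diff_distrib distrib_left mult.left_commute[of lam])
  qed simp
  then have "(\<Sum>i=1..N. p i * payoff i j - lam * (p i * ln (p i / q i)))
      = (\<Sum>i=1..N. p i * (lam * ln ?Z) - lam * (p i * ln (p i / logit_rule lam q j i)))"
    by (rule sum.cong[OF refl])
  then show ?thesis
    using assms(3)
    by (simp add: sum_subtractf sum_distrib_left[symmetric] sum_distrib_right[symmetric] distribution_def)
qed

section \<open>Reduction to a problem over choice probabilities\<close>

lemma choice_prob_distribution:
  assumes "distribution N \<mu>" "decision_rule N \<pi>"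
  shows "distribution N (choice_prob N \<mu> \<pi>)"
proof -
  have "(\<Sum>i=1..N. choice_prob N \<mu> \<pi> i) = (\<Sum>j=1..N. \<mu> j * (\<Sum>i=1..N. \<pi> j i))"
    unfolding choice_prob_def by (subst sum.swap) (simp add: sum_distrib_left)
  also have "\<dots> = (\<Sum>j=1..N. \<mu> j)"
    using assms(2) by (intro sum.cong) (auto simp: decision_rule_def distribution_def)
  finally show ?thesis
    using assms by (auto simp: distribution_def decision_rule_def choice_prob_def intro!: sum_nonneg)
qed

lemma agent_objective_alt:
  "agent_objective N lam \<mu> \<pi> = (\<Sum>j=1..N. \<mu> j * ((\<Sum>i=1..N. \<pi> j i * payoff i j)
     - lam * (\<Sum>i=1..N. \<pi> j i * ln (\<pi> j i / choice_prob N \<mu> \<pi> i))))"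
  by (simp add: agent_objective_def information_cost_def sum_distrib_left sum_subtractf
      right_diff_distrib mult_ac)

lemma choice_prob_eq_0D:
  assumes "distribution N \<mu>" "decision_rule N \<pi>" "i \<in> {1..N}" "j \<in> {1..N}"
    and "choice_prob N \<mu> \<pi> i = 0"
  shows "\<mu> j * \<pi> j i = 0"
proof -
  have "\<forall>j\<in>{1..N}. \<mu> j * \<pi> j i = 0"
    using assms unfolding choice_prob_def
    by (subst sum_nonneg_eq_0_iff[symmetric]) (auto simp: distribution_def decision_rule_def)
  then show ?thesis using assms(4) by blast
qed

text \<open>In each state the divergence from the logit rule built on the rule's own choice
  probabilities is nonnegative, and dropping it leaves the reduced objective.\<close>

lemma agent_objective_le_reduced:
  assumes "lam > 0" "distribution N \<mu>" "decision_rule N \<pi>"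
  shows "agent_objective N lam \<mu> \<pi> \<le> lam * reduced_objective N lam \<mu> (choice_prob N \<mu> \<pi>)"
proof -
  let ?q = "choice_prob N \<mu> \<pi>"
  have q: "distribution N ?q" using assms choice_prob_distribution by blast
  have "\<mu> j * ((\<Sum>i=1..N. \<pi> j i * payoff i j) - lam * (\<Sum>i=1..N. \<pi> j i * ln (\<pi> j i / ?q i)))
      \<le> \<mu> j * (lam * ln (1 + (exp (1 / lam) - 1) * ?q j))" if j: "j \<in> {1..N}" for j
  \<comment> \<open>A zero choice probability forces \<open>\<pi> j i = 0\<close> only in states of
    positive prior; the other states contribute 0 to both sides.\<close>
  proof (cases "\<mu> j = 0")
    case False
    then have pos: "\<mu> j > 0" using assms(2) j by (force simp: distribution_def order_less_le)
    have p: "distribution N (\<pi> j)" using assms(3) j by (simp add: decision_rule_def)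
    have supp: "\<pi> j i = 0" if "i \<in> {1..N}" "?q i = 0" for i
      using choice_prob_eq_0D[OF assms(2,3) that(1) j that(2)] False by simp
    have l: "distribution N (logit_rule lam ?q j)"
      using logit_rule_distribution[OF assms(1) q j] .
    have "0 \<le> (\<Sum>i=1..N. \<pi> j i * ln (\<pi> j i / logit_rule lam ?q j i))"
      using gibbs_sum[of "{1..N}" "\<pi> j" "logit_rule lam ?q j"] p l supp
        logit_rule_eq_0_iff[OF assms(1) q j]
      by (simp add: distribution_def)
    then have "0 \<le> lam * (\<Sum>i=1..N. \<pi> j i * ln (\<pi> j i / logit_rule lam ?q j i))"
      using assms(1) by simp
    then show ?thesis
      using payoff_minus_divergence[OF assms(1) q p j supp] pos by simp
  qed simp
  then show ?thesis
    unfolding agent_objective_alt reduced_objective_def sum_distrib_left[of lam]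
      mult.left_commute[of lam "\<mu> _"]
    by (rule sum_mono)
qed

text \<open>Among reference distributions, the rule's own choice probabilities minimize the expected
  divergence: the gap for another \<open>q\<close> is the divergence of
  \<open>choice_prob N \<mu> \<pi>\<close> from \<open>q\<close>.\<close>

lemma information_cost_le_divergence:
  assumes "distribution N \<mu>" "decision_rule N \<pi>" "distribution N q"
    and supp: "\<And>i j. i \<in> {1..N} \<Longrightarrow> j \<in> {1..N} \<Longrightarrow> q i = 0 \<Longrightarrow> \<pi> j i = 0"
  shows "information_cost N \<mu> \<pi> \<le> (\<Sum>j=1..N. \<mu> j * (\<Sum>i=1..N. \<pi> j i * ln (\<pi> j i / q i)))"
proof -
  let ?b = "choice_prob N \<mu> \<pi>"
  have b: "distribution N ?b" using assms(1,2) by (rule choice_prob_distribution)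
  have split: "\<mu> j * \<pi> j i * ln (\<pi> j i / q i)
      = \<mu> j * \<pi> j i * ln (\<pi> j i / ?b i) + \<mu> j * \<pi> j i * ln (?b i / q i)"
    if ij: "i \<in> {1..N}" "j \<in> {1..N}" for i j
  proof (cases "\<mu> j * \<pi> j i = 0")
    case False
    have "\<pi> j i > 0"
      using assms(2) ij False by (force simp: decision_rule_def distribution_def order_less_le)
    moreover have "?b i > 0"
      using b choice_prob_eq_0D[OF assms(1,2) ij] False ij(1)
      by (force simp: distribution_def order_less_le)
    moreover have "q i > 0"
      using assms(3) supp[OF ij] False ij(1) by (force simp: distribution_def order_less_le)
    ultimately show ?thesis by (simp add: ln_div algebra_simps)
  next
    case True
    then show ?thesis by (simp only: mult_zero_left add_0)
  qed
  have "(\<Sum>j=1..N. \<mu> j * (\<Sum>i=1..N. \<pi> j i * ln (\<pi> j i / q i)))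
      = (\<Sum>j=1..N. \<Sum>i=1..N. \<mu> j * \<pi> j i * ln (\<pi> j i / ?b i) + \<mu> j * \<pi> j i * ln (?b i / q i))"
    unfolding sum_distrib_left mult.assoc[symmetric] using split by (intro sum.cong) auto
  also have "\<dots> = information_cost N \<mu> \<pi> + (\<Sum>j=1..N. \<Sum>i=1..N. \<mu> j * \<pi> j i * ln (?b i / q i))"
    by (simp add: sum.distrib information_cost_def)
  \<comment> \<open>The new logarithm does not depend on the state, so summing over states first
    produces the choice probability.\<close>
  also have "(\<Sum>j=1..N. \<Sum>i=1..N. \<mu> j * \<pi> j i * ln (?b i / q i)) = (\<Sum>i=1..N. ?b i * ln (?b i / q i))"
    by (subst sum.swap) (simp add: choice_prob_def sum_distrib_right)
  finally have eq: "(\<Sum>j=1..N. \<mu> j * (\<Sum>i=1..N. \<pi> j i * ln (\<pi> j i / q i)))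
      = information_cost N \<mu> \<pi> + (\<Sum>i=1..N. ?b i * ln (?b i / q i))" .
  have "?b i = 0" if "i \<in> {1..N}" "q i = 0" for i
    using supp that by (simp add: choice_prob_def)
  then have "0 \<le> (\<Sum>i=1..N. ?b i * ln (?b i / q i))"
    using gibbs_sum[of "{1..N}" ?b q] b assms(3) by (simp add: distribution_def)
  with eq show ?thesis by linarith
qed

text \<open>For the logit rule itself the divergence term vanishes, so with reference
  \<open>q\<close> equality holds. Its choice probabilities may differ from \<open>q\<close>, but
  passing to them only lowers the cost.\<close>

lemma reduced_le_agent_objective_logit:
  assumes "lam > 0" "distribution N \<mu>" "distribution N q"
  shows "lam * reduced_objective N lam \<mu> q \<le> agent_objective N lam \<mu> (logit_rule lam q)"
proof -
  let ?\<pi> = "logit_rule lam q"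
  have rule: "decision_rule N ?\<pi>"
    using logit_rule_distribution[OF assms(1,3)] by (simp add: decision_rule_def)
  have supp: "?\<pi> j i = 0" if "q i = 0" for i j
    using that by (simp add: logit_rule_def)
  have "\<mu> j * (lam * ln (1 + (exp (1 / lam) - 1) * q j))
      = \<mu> j * ((\<Sum>i=1..N. ?\<pi> j i * payoff i j) - lam * (\<Sum>i=1..N. ?\<pi> j i * ln (?\<pi> j i / q i)))"
    if j: "j \<in> {1..N}" for j
  proof -
    have "(\<Sum>i=1..N. ?\<pi> j i * ln (?\<pi> j i / ?\<pi> j i)) = 0"
      by (intro sum.neutral) simp
    then show ?thesis
      using payoff_minus_divergence[OF assms(1,3) logit_rule_distribution[OF assms(1,3) j] j supp]
      by (simp only: mult_zero_right diff_zero)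
  qed
  then have "lam * reduced_objective N lam \<mu> q = (\<Sum>j=1..N. \<mu> j * ((\<Sum>i=1..N. ?\<pi> j i * payoff i j)
      - lam * (\<Sum>i=1..N. ?\<pi> j i * ln (?\<pi> j i / q i))))"
    unfolding reduced_objective_def sum_distrib_left[of lam] mult.left_commute[of lam "\<mu> _"]
    by (rule sum.cong[OF refl])
  also have "\<dots> = (\<Sum>j=1..N. \<mu> j * (\<Sum>i=1..N. ?\<pi> j i * payoff i j))
      - lam * (\<Sum>j=1..N. \<mu> j * (\<Sum>i=1..N. ?\<pi> j i * ln (?\<pi> j i / q i)))"
    by (simp only: right_diff_distrib sum_subtractf mult.left_commute[of _ lam] sum_distrib_left[symmetric])
  also have "\<dots> \<le> agent_objective N lam \<mu> ?\<pi>"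
    unfolding agent_objective_def
    using information_cost_le_divergence[OF assms(2) rule assms(3) supp] assms(1) by simp
  finally show ?thesis .
qed

text \<open>Optimality of \<open>\<pi>\<close> against the logit rule for \<open>q\<close> is
  sandwiched between the two preceding bounds.\<close>

lemma agent_solution_maximizes_reduced:
  assumes "lam > 0" "distribution N \<mu>" "agent_solution N lam \<mu> \<pi>" "distribution N q"
  shows "reduced_objective N lam \<mu> q \<le> reduced_objective N lam \<mu> (choice_prob N \<mu> \<pi>)"
proof -
  have "decision_rule N (logit_rule lam q)"
    using logit_rule_distribution[OF assms(1,4)] by (simp add: decision_rule_def)
  then have "agent_objective N lam \<mu> (logit_rule lam q) \<le> agent_objective N lam \<mu> \<pi>"
    and "decision_rule N \<pi>"
    using assms(3) by (auto simp: agent_solution_def is_arg_max_linorder)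
  then have "lam * reduced_objective N lam \<mu> q
      \<le> lam * reduced_objective N lam \<mu> (choice_prob N \<mu> \<pi>)"
    using reduced_le_agent_objective_logit[OF assms(1,2,4)] agent_objective_le_reduced[OF assms(1,2)]
    by fastforce
  then show ?thesis using assms(1) by simp
qed

section \<open>First-order conditions\<close>

text \<open>Moving a small mass \<open>t\<close> from \<open>j\<close> to \<open>i\<close> stays in
  the simplex because \<open>\<beta> j > 0\<close>, so the right derivative of the objective at
  \<open>t = 0\<close> cannot be positive. As \<open>\<beta> i\<close> may be 0, only
  \<open>t \<ge> 0\<close> is compared.\<close>

lemma first_order_condition:
  assumes lam: "lam > 0" and \<beta>: "distribution N \<beta>"
    and max: "\<And>q. distribution N q \<Longrightarrow> reduced_objective N lam \<mu> q \<le> reduced_objective N lam \<mu> \<beta>"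
    and ij: "i \<in> {1..N}" "j \<in> {1..N}" and pos: "\<beta> j > 0"
  shows "\<mu> i * (1 + (exp (1 / lam) - 1) * \<beta> j) \<le> \<mu> j * (1 + (exp (1 / lam) - 1) * \<beta> i)"
proof (cases "i = j")
  case False
  define K where "K = exp (1 / lam) - 1"
  have K: "K > 0" using lam by (simp add: K_def)
  have \<beta>0: "\<beta> k \<ge> 0" if "k \<in> {1..N}" for k using \<beta> that by (simp add: distribution_def)
  have Z: "1 + K * \<beta> k > 0" if "k \<in> {1..N}" for k
    using partition_pos[OF lam \<beta>0[OF that]] by (simp add: K_def)
  define g where "g t = \<mu> i * ln (1 + K * (\<beta> i + t)) + \<mu> j * ln (1 + K * (\<beta> j - t))" for t
  have le: "g t \<le> g 0" if t: "0 \<le> t" "t \<le> \<beta> j" for t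
  proof -
    define q where "q = \<beta>(i := \<beta> i + t, j := \<beta> j - t)"
    have rest: "k \<in> {1..N} - {i} - {j} \<Longrightarrow> q k = \<beta> k" for k by (simp add: q_def)
    have split: "(\<Sum>k=1..N. f k) = f i + f j + sum f ({1..N} - {i} - {j})" for f :: "nat \<Rightarrow> real"
      using ij False sum.remove[of "{1..N}" i f] sum.remove[of "{1..N} - {i}" j f] by simp
    have "(\<Sum>k=1..N. q k) = (\<Sum>k=1..N. \<beta> k)"
      unfolding split using False rest by (simp add: q_def)
    then have "distribution N q"
      using \<beta> t ij by (auto simp: distribution_def q_def)
    then have "reduced_objective N lam \<mu> q \<le> reduced_objective N lam \<mu> \<beta>" by (rule max)
    then show ?thesis
      unfolding reduced_objective_def split K_def[symmetric] g_def
      using False rest by (simp add: q_def)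
  qed
  have deriv: "(g has_real_derivative \<mu> i * K / (1 + K * \<beta> i) - \<mu> j * K / (1 + K * \<beta> j)) (at 0)"
    unfolding g_def using Z[OF ij(1)] Z[OF ij(2)]
    by (auto intro!: derivative_eq_intros simp: field_simps)
  have "\<mu> i * K / (1 + K * \<beta> i) - \<mu> j * K / (1 + K * \<beta> j) \<le> 0"
  proof (rule ccontr)
    assume "\<not> ?thesis"
    then obtain d where d: "d > 0" "\<And>h. 0 < h \<Longrightarrow> h < d \<Longrightarrow> g 0 < g (0 + h)"
      using DERIV_pos_inc_right[OF deriv] by fastforce
    \<comment> \<open>Halving \<open>d\<close> keeps the shift strictly inside the interval of
      increase; the bound \<open>\<beta> j\<close> keeps it feasible.\<close>
    have "min (d / 2) (\<beta> j) > 0" "min (d / 2) (\<beta> j) < d" "min (d / 2) (\<beta> j) \<le> \<beta> j"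
      using d(1) pos by auto
    then show False using d(2)[of "min (d / 2) (\<beta> j)"] le[of "min (d / 2) (\<beta> j)"] by simp
  qed
  then have "K * (\<mu> i * (1 + K * \<beta> j)) \<le> K * (\<mu> j * (1 + K * \<beta> i))"
    using Z[OF ij(1)] Z[OF ij(2)] by (simp add: divide_le_eq le_divide_eq mult_ac)
  then show ?thesis using K by (simp add: K_def)
qed simp

lemma agent_solution_choice_prob:
  assumes "lam > 0" "distribution N \<mu>" "agent_solution N lam \<mu> \<pi>"
  shows "distribution N (choice_prob N \<mu> \<pi>)"
    and "\<And>i j. i \<in> {1..N} \<Longrightarrow> j \<in> {1..N} \<Longrightarrow> choice_prob N \<mu> \<pi> j > 0 \<Longrightarrow>
      \<mu> i * (1 + (exp (1 / lam) - 1) * choice_prob N \<mu> \<pi> j)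
      \<le> \<mu> j * (1 + (exp (1 / lam) - 1) * choice_prob N \<mu> \<pi> i)"
proof -
  have "decision_rule N \<pi>" using assms(3) by (simp add: agent_solution_def is_arg_max_def)
  then show d: "distribution N (choice_prob N \<mu> \<pi>)"
    using assms(2) choice_prob_distribution by blast
  show "\<And>i j. i \<in> {1..N} \<Longrightarrow> j \<in> {1..N} \<Longrightarrow> choice_prob N \<mu> \<pi> j > 0 \<Longrightarrow>
      \<mu> i * (1 + (exp (1 / lam) - 1) * choice_prob N \<mu> \<pi> j)
      \<le> \<mu> j * (1 + (exp (1 / lam) - 1) * choice_prob N \<mu> \<pi> i)"
    using first_order_condition[OF assms(1) d] agent_solution_maximizes_reduced[OF assms] by blast
qed

section \<open>Comparison of the two agents\<close>

lemma sum_sqrt_pos: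
  assumes "distribution N \<mu>"
  shows "(\<Sum>j=1..N. sqrt (\<mu> j)) > 0"
proof -
  have "\<exists>k\<in>{1..N}. \<mu> k \<noteq> 0"
  proof (rule ccontr)
    assume "\<not> ?thesis"
    then have "(\<Sum>j=1..N. \<mu> j) = 0" by (intro sum.neutral) blast
    then show False using assms by (simp add: distribution_def)
  qed
  then obtain k where "k \<in> {1..N}" "\<mu> k \<noteq> 0" by blast
  then show ?thesis
    using assms by (intro sum_pos2[of _ k]) (force simp: distribution_def order_less_le)+
qed

lemma optimal_agent_prior_distribution:
  assumes "distribution N \<mu>"
  shows "distribution N (optimal_agent_prior N \<mu>)"
  using sum_sqrt_pos[OF assms] assms
  by (auto simp: distribution_def optimal_agent_prior_def sum_divide_distrib[symmetric])

theorem proposition2: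
  fixes N :: nat and lam :: real and \<mu>p :: "nat \<Rightarrow> real"
    and \<pi>_bar \<pi>_star :: "nat \<Rightarrow> nat \<Rightarrow> real"
  assumes "N > 2" and "lam > 0"
    and "distribution N \<mu>p"
    and "\<forall>i\<in>{1..N}. \<forall>j\<in>{1..N}. i \<le> j \<longrightarrow> \<mu>p j \<le> \<mu>p i"
    and "agent_solution N lam \<mu>p \<pi>_bar"
    and "agent_solution N lam (optimal_agent_prior N \<mu>p) \<pi>_star"
  shows "consideration_set N \<mu>p \<pi>_bar
           \<subseteq> consideration_set N (optimal_agent_prior N \<mu>p) \<pi>_star"
proof
  define K where "K = exp (1 / lam) - 1"
  have K: "K > 0" using assms(2) by (simp add: K_def)
  define b where "b = choice_prob N \<mu>p \<pi>_bar"
  define s where "s = choice_prob N (optimal_agent_prior N \<mu>p) \<pi>_star"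
  define S where "S = (\<Sum>j=1..N. sqrt (\<mu>p j))"
  have S: "S > 0" unfolding S_def using assms(3) by (rule sum_sqrt_pos)
  note bar = agent_solution_choice_prob[OF assms(2,3,5), folded b_def K_def]
  note star = agent_solution_choice_prob[OF assms(2) optimal_agent_prior_distribution[OF assms(3)] assms(6),
      folded s_def K_def]
  have b0: "b k \<ge> 0" and s0: "s k \<ge> 0" and \<mu>0: "\<mu>p k \<ge> 0" if "k \<in> {1..N}" for k
    using bar(1) star(1) assms(3) that by (simp_all add: distribution_def)
  \<comment> \<open>The normalizer \<open>S\<close> divides both sides of the condition and
    cancels.\<close>
  have star_foc: "sqrt (\<mu>p k) * (1 + K * s j) \<le> sqrt (\<mu>p j) * (1 + K * s k)"
    if "k \<in> {1..N}" "j \<in> {1..N}" "s j > 0" for j k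
    using star(2)[OF that] S
    unfolding optimal_agent_prior_def S_def[symmetric] by (simp add: divide_le_cancel)
  fix i assume "i \<in> consideration_set N \<mu>p \<pi>_bar"
  then have i: "i \<in> {1..N}" "b i > 0" by (auto simp: consideration_set_def b_def)
  \<comment> \<open>Otherwise the aligned agent's conditions against \<open>i\<close> would force
    every prior probability to be 0.\<close>
  have "\<mu>p i \<noteq> 0"
  proof
    assume 0: "\<mu>p i = 0"
    have "1 + K * b i > 0" using K i by (simp add: add_pos_pos)
    then have "\<mu>p k = 0" if "k \<in> {1..N}" for k
      using bar(2)[OF that i] 0 \<mu>0[OF that] by (simp add: mult_le_0_iff)
    then show False using assms(3) by (simp add: distribution_def)
  qed
  then have \<mu>i: "\<mu>p i > 0" using \<mu>0[OF i(1)] by simp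
  have "s i > 0"
  proof (rule ccontr)
    assume "\<not> s i > 0"
    then have si: "s i = 0" using s0[OF i(1)] by simp
    have lt: "s j < b j" if j: "j \<in> {1..N}" "s j > 0" for j
    proof -
      have ge1: "1 \<le> 1 + K * s j" using K j by simp
      have "(sqrt (\<mu>p i) * (1 + K * s j))\<^sup>2 \<le> (sqrt (\<mu>p j))\<^sup>2"
        using star_foc[OF i(1) j] si ge1 \<mu>i by (intro power_mono) auto
      then have "\<mu>p i * (1 + K * s j)\<^sup>2 \<le> \<mu>p j"
        using \<mu>i \<mu>0[OF j(1)] by (simp add: power_mult_distrib)
      moreover have "\<mu>p i * (1 + K * s j) \<le> \<mu>p i * (1 + K * s j)\<^sup>2"
        using ge1 \<mu>i by (intro mult_left_mono self_le_power) auto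
      ultimately have 1: "\<mu>p i * (1 + K * s j) \<le> \<mu>p j" by linarith
      then have "\<mu>p j > 0"
        using \<mu>i ge1 by (smt (verit) mult_pos_pos)
      \<comment> \<open>Strictness comes from \<open>b i > 0\<close>; the aligned agent's condition
        for \<open>j\<close> against \<open>i\<close> then bounds the right-hand side.\<close>
      then have "\<mu>p j < \<mu>p j * (1 + K * b i)"
        using K i by (simp add: algebra_simps)
      with bar(2)[OF j(1) i] 1 have "\<mu>p i * (1 + K * s j) < \<mu>p i * (1 + K * b j)" by linarith
      then show ?thesis using \<mu>i K by simp
    qed
    have le: "s k \<le> b k" if "k \<in> {1..N}" for k
      using lt[OF that] b0[OF that] by (cases "s k > 0") auto
    \<comment> \<open>The index \<open>i\<close> itself witnesses strictness, since
      \<open>s i = 0 < b i\<close>; yet both sums equal 1.\<close>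
    have "(\<Sum>k=1..N. s k) < (\<Sum>k=1..N. b k)"
      using le i si by (intro sum_strict_mono_ex1) (auto intro!: bexI[of _ i])
    then show False using bar(1) star(1) by (simp add: distribution_def)
  qed
  then show "i \<in> consideration_set N (optimal_agent_prior N \<mu>p) \<pi>_star"
    using i(1) by (simp add: consideration_set_def s_def)
qed

end
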